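(* Let $f:\mathbb{R}^d\to\mathbb{R}\cup\{+\infty\}$ be proper, closed, convex and $L$-Lipschitz smooth ($L>0$), with nonempty solution set; let $f_*=\min f$ and let $\mathbf{x}_*$ be any minimizer. Let $K\ge 1$ and let $\mathbf{x}_0,\dots,\mathbf{x}_K$ be generated by iGFGM (see context) with inexact gradients $\tilde\nabla f(\mathbf{x}_k)=\nabla f(\mathbf{x}_k)+\mathbf{e}_k$ satisfying $\|\mathbf{e}_k\|^2\le b_k^2$, where $b_k\ge0$, $k=0,\dots,K-1$. Then $$f(\mathbf{x}_K)-f_*-\frac{1}{2L}\|\nabla f(\mathbf{x}_K)\|^2\le\frac{L\|\mathbf{x}_0-\mathbf{x}_*\|^2}{2A_K}+\sum_{k=0}^{K-1}\hat u_kb_k^2,$$ where $\hat u_k=(\mathbf{H}\mathbf{b})_k/b_k$ with $\mathbf{b}=(b_0,\dots,b_{K-1})^\top$ and $\mathbf{H}$ given in the context (the product $\hat u_kb_k^2$ being read as $b_k(\mathbf{H}\mathbf{b})_k$). In particular, when $b_i\equiv b>0$, for $k=0,\dots,K-1$, $$\hat u_k=\frac{A_k^2(1+\alpha_{k+1})}{2LA_K(2A_{k+1}-\alpha_{k+1}^2)}+\sum_{i=k+1}^{K}\frac{\alpha_kA_{i-1}\alpha_i(1+\alpha_i)}{2LA_K(2A_i-\alpha_i^2)}.$$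
   Context: iGFGM (Inexact Generalized Fast Gradient Method): $\mathbf{z}_0=\mathbf{x}_0\in\mathbb{R}^d$, $A_0=\alpha_0=1$, parameters $\lambda_1,\dots,\lambda_K\in[0,1]$. For $k=0,\dots,K-1$: $$\mathbf{y}_{k+1}=\mathbf{x}_k-\tfrac1L\tilde\nabla f(\mathbf{x}_k),\qquad \mathbf{z}_{k+1}=\mathbf{z}_k-\tfrac{1}{L}\alpha_k\tilde\nabla f(\mathbf{x}_k),$$ $$\alpha_{k+1}=\frac{\lambda_{k+1}+\sqrt{4\lambda_{k+1}A_k+\lambda_{k+1}^2}}{2},\qquad A_{k+1}=A_k+\alpha_{k+1},$$ $$\mathbf{x}_{k+1}=\Big(1-\frac{\alpha_{k+1}}{A_{k+1}}\Big)\mathbf{y}_{k+1}+\frac{\alpha_{k+1}}{A_{k+1}}\mathbf{z}_{k+1}.$$ (Thus $\alpha_k^2=\lambda_kA_k\le A_k$ for $k\ge1$.) The symmetric matrix $\mathbf{H}\in\mathbb{R}^{K\times K}$, with rows and columns indexed by $0,\dots,K-1$, is $$H_{il}=\sum_{j=\max\{i,l\}+1}^{K}\frac{c_{i,j}\,c_{l,j}}{2LA_K(2A_j-\alpha_j^2)},\qquad c_{j-1,j}=A_{j-1}+\alpha_{j-1}\alpha_j,\quad c_{i,j}=\alpha_i\alpha_j\ \ (i\le j-2).$$ "$L$-Lipschitz smooth" means differentiable with $L$-Lipschitz gradient; $\|\cdot\|$ is the Euclidean norm. *)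

theory Defs
  imports "HOL-Analysis.Analysis"
begin

section \<open>Extended-real-valued convex and smooth functions\<close>

definition proper_fun :: "('a \<Rightarrow> ereal) \<Rightarrow> bool" where
  "proper_fun f \<longleftrightarrow> (\<forall>x. f x \<noteq> -\<infinity>) \<and> (\<exists>x. f x \<noteq> \<infinity>)"

definition ereal_epigraph :: "('a \<Rightarrow> ereal) \<Rightarrow> ('a \<times> real) set" where
  "ereal_epigraph f = {(x, t). f x \<le> ereal t}"

definition closed_fun :: "('a::topological_space \<Rightarrow> ereal) \<Rightarrow> bool" where
  "closed_fun f \<longleftrightarrow> closed (ereal_epigraph f)"

definition convex_fun :: "('a::real_vector \<Rightarrow> ereal) \<Rightarrow> bool" where
  "convex_fun f \<longleftrightarrow> convex (ereal_epigraph f)"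

text \<open>
  The gradient is that of the real-valued function underlying \<open>f\<close>; it is meaningful only where
  \<open>f\<close> is finite in a neighbourhood, which holds everywhere under \<open>lipschitz_smooth\<close> below.
\<close>

definition grad :: "('a::euclidean_space \<Rightarrow> ereal) \<Rightarrow> 'a \<Rightarrow> 'a" where
  "grad f x = (THE g. GDERIV (\<lambda>y. real_of_ereal (f y)) x :> g)"

text \<open>Differentiability on the whole space includes finiteness on the whole space.\<close>

definition lipschitz_smooth :: "real \<Rightarrow> ('a::euclidean_space \<Rightarrow> ereal) \<Rightarrow> bool" where
  "lipschitz_smooth L f \<longleftrightarrow>
     (\<forall>x. \<bar>f x\<bar> \<noteq> \<infinity>) \<and>
     (\<forall>x. (\<lambda>y. real_of_ereal (f y)) differentiable (at x)) \<and>
     L-lipschitz_on UNIV (grad f)"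

section \<open>The inexact generalized fast gradient method\<close>

text \<open>Only \<open>lam k\<close> with \<open>k \<ge> 1\<close> is ever used.\<close>

fun alpha :: "(nat \<Rightarrow> real) \<Rightarrow> nat \<Rightarrow> real"
  and A_sum :: "(nat \<Rightarrow> real) \<Rightarrow> nat \<Rightarrow> real" where
  "alpha lam 0 = 1"
| "alpha lam (Suc k) = (lam (Suc k) + sqrt (4 * lam (Suc k) * A_sum lam k + (lam (Suc k))\<^sup>2)) / 2"
| "A_sum lam 0 = 1"
| "A_sum lam (Suc k) = A_sum lam k + alpha lam (Suc k)"

text \<open>
  \<open>g k\<close> is the inexact gradient used at \<open>x k\<close>. The sequences are constrained up to index \<open>K\<close>
  only, and \<open>y 0\<close> is irrelevant.
\<close>

definition iGFGM ::
  "real \<Rightarrow> (nat \<Rightarrow> real) \<Rightarrow> nat \<Rightarrow> (nat \<Rightarrow> 'a::real_vector) \<Rightarrow>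
   (nat \<Rightarrow> 'a) \<Rightarrow> (nat \<Rightarrow> 'a) \<Rightarrow> (nat \<Rightarrow> 'a) \<Rightarrow> bool" where
  "iGFGM L lam K g x y z \<longleftrightarrow>
     z 0 = x 0 \<and>
     (\<forall>k<K.
        y (Suc k) = x k - (1 / L) *\<^sub>R g k \<and>
        z (Suc k) = z k - (1 / L * alpha lam k) *\<^sub>R g k \<and>
        x (Suc k) = (1 - alpha lam (Suc k) / A_sum lam (Suc k)) *\<^sub>R y (Suc k)
                    + (alpha lam (Suc k) / A_sum lam (Suc k)) *\<^sub>R z (Suc k))"

section \<open>The error matrix\<close>

text \<open>Used for \<open>i < j\<close> only: the first branch is \<open>i = j - 1\<close>, the second \<open>i \<le> j - 2\<close>.\<close>

definition c_coeff :: "(nat \<Rightarrow> real) \<Rightarrow> nat \<Rightarrow> nat \<Rightarrow> real" where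
  "c_coeff lam i j =
     (if Suc i = j then A_sum lam i + alpha lam i * alpha lam j else alpha lam i * alpha lam j)"

text \<open>Row and column indices range over \<open>{..<K}\<close>.\<close>

definition H_mat :: "real \<Rightarrow> (nat \<Rightarrow> real) \<Rightarrow> nat \<Rightarrow> nat \<Rightarrow> nat \<Rightarrow> real" where
  "H_mat L lam K i l =
     (\<Sum>j = max i l + 1..K.
        c_coeff lam i j * c_coeff lam l j / (2 * L * A_sum lam K * (2 * A_sum lam j - (alpha lam j)\<^sup>2)))"

definition H_vec :: "real \<Rightarrow> (nat \<Rightarrow> real) \<Rightarrow> nat \<Rightarrow> (nat \<Rightarrow> real) \<Rightarrow> nat \<Rightarrow> real" where
  "H_vec L lam K b k = (\<Sum>l<K. H_mat L lam K k l * b l)"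

definition u_hat :: "real \<Rightarrow> (nat \<Rightarrow> real) \<Rightarrow> nat \<Rightarrow> (nat \<Rightarrow> real) \<Rightarrow> nat \<Rightarrow> real" where
  "u_hat L lam K b k = H_vec L lam K b k / b k"

text \<open>
  With the convention \<open>t / 0 = 0\<close>, the product of \<open>u_hat\<close> with the squared error bound has the
  intended value also when the bound vanishes.
\<close>

lemma u_hat_times_square: "u_hat L lam K b k * (b k)\<^sup>2 = b k * H_vec L lam K b k"
  by (simp add: u_hat_def power2_eq_square)

end

theory Submission
  imports Defs
begin

text \<open>
  Let \<open>g k\<close> be the exact gradient at \<open>x k\<close>, and let \<open>w\<close> be the sequence that starts at \<open>x 0\<close> and
  makes the steps of \<open>z\<close> with exact gradients. By cocoercivity, the potential
  \<open>A k * (f (x k) - f\<^sub>* - norm (g k)\<^sup>2 / (2 L)) + L / 2 * norm (w (k + 1) - x\<^sub>*)\<^sup>2\<close> increases from \<open>j - 1\<close>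
  to \<open>j\<close> by at most \<open>- (g j \<bullet> s j) / L - (2 A j - \<alpha> j\<^sup>2) / (2 L) * norm (g j)\<^sup>2\<close>, where
  \<open>s j = (\<Sum>i<j. c i j e i)\<close>. Completing the square in \<open>g j\<close> bounds this by
  \<open>norm (s j)\<^sup>2 / (2 L (2 A j - \<alpha> j\<^sup>2))\<close>, and the triangle inequality bounds the sum over \<open>j\<close>
  by the quadratic form of \<open>H\<close> at \<open>b\<close>.
\<close>

section \<open>Gradients and convexity of finite extended-real-valued functions\<close>

lemma differentiable_imp_GDERIV:
  fixes F :: "'a::euclidean_space \<Rightarrow> real"
  assumes "F differentiable (at x)"
  obtains g where "GDERIV F x :> g"
proof -
  obtain F' where F': "(F has_derivative F') (at x)"
    using assms by (auto simp: differentiable_def)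
  \<comment> \<open>Riesz representation: the adjoint of a real-valued linear map, applied to 1, is
    the vector that represents it.\<close>
  then have "F' h = h \<bullet> adjoint F' 1" for h
    by (simp add: adjoint_works has_derivative_linear)
  then have "F' = (\<lambda>h. h \<bullet> adjoint F' 1)" ..
  with F' have "GDERIV F x :> adjoint F' 1"
    by (simp add: gderiv_def)
  then show thesis ..
qed

text \<open>Makes the definite description in \<open>grad\<close> usable. A derivative is unique,
  and two vectors with the same inner products against all vectors are equal.\<close>

lemma GDERIV_grad:
  fixes f :: "'a::euclidean_space \<Rightarrow> ereal"
  assumes "(\<lambda>y. real_of_ereal (f y)) differentiable (at x)"
  shows "GDERIV (\<lambda>y. real_of_ereal (f y)) x :> grad f x"
proof -
  obtain g where g: "GDERIV (\<lambda>y. real_of_ereal (f y)) x :> g"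
    using differentiable_imp_GDERIV[OF assms] .
  show ?thesis
    unfolding grad_def
  proof (rule theI[where
        P = "\<lambda>g. GDERIV (\<lambda>y. real_of_ereal (f y)) x :> g", OF g])
    fix h assume h: "GDERIV (\<lambda>y. real_of_ereal (f y)) x :> h"
    have "(\<lambda>v. v \<bullet> h) = (\<lambda>v. v \<bullet> g)"
      using g h unfolding gderiv_def by (rule has_derivative_unique[rotated])
    then show "h = g"
      using vector_eq_ldot[of h g] by (simp add: fun_eq_iff)
  qed
qed

text \<open>As \<open>f\<close> takes no infinite value, passing to real values leaves the epigraph
  unchanged, and convexity is read off from it.\<close>

lemma convex_on_real_of_ereal:
  assumes "convex_fun f" and fin: "\<And>x. \<bar>f x\<bar> \<noteq> \<infinity>"
  shows "convex_on UNIV (\<lambda>x. real_of_ereal (f x))"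
proof -
  have epi: "epigraph UNIV (\<lambda>x. real_of_ereal (f x)) = ereal_epigraph f"
  proof -
    have "real_of_ereal (f x) \<le> t \<longleftrightarrow> f x \<le> ereal t" for x t
      using fin[of x] by (cases "f x") auto
    then show ?thesis
      by (auto simp: epigraph_def ereal_epigraph_def)
  qed
  then show ?thesis
    using assms(1) unfolding convex_fun_def epi[symmetric] by (simp only: convex_epigraph)
qed

section \<open>First-order inequalities for convex and for smooth functions\<close>

lemma GDERIV_along_line:
  assumes "\<And>u. GDERIV F u :> G u"
  shows "((\<lambda>t. F (x + t *\<^sub>R v)) has_real_derivative G (x + t *\<^sub>R v) \<bullet> v) (at t within S)"
proof -
  have "(F has_derivative (\<lambda>h. h \<bullet> G (x + t *\<^sub>R v))) (at (x + t *\<^sub>R v))"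
    using assms by (simp add: gderiv_def)
  then have "((\<lambda>t. F (x + t *\<^sub>R v)) has_derivative (\<lambda>h. (h *\<^sub>R v) \<bullet> G (x + t *\<^sub>R v))) (at t within S)"
    by (rule has_derivative_compose[rotated]) (auto intro!: derivative_eq_intros)
  then show ?thesis
    unfolding has_field_derivative_def
    by (rule has_derivative_eq_rhs) (simp add: fun_eq_iff inner_commute)
qed

lemma convex_on_gradient_le:
  assumes conv: "convex_on UNIV F" and der: "\<And>u. GDERIV F u :> G u"
  shows "F x + G x \<bullet> (y - x) \<le> F y"
proof -
  \<comment> \<open>Restriction to the line through \<open>x\<close> and \<open>y\<close> reduces
    the claim to the tangent inequality for a convex function of one variable, between 0 and
    1.\<close>
  define \<phi> where "\<phi> t = F (x + t *\<^sub>R (y - x))" for t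
  have aff: "x + ((1 - t) * a + t * b) *\<^sub>R (y - x)
      = (1 - t) *\<^sub>R (x + a *\<^sub>R (y - x)) + t *\<^sub>R (x + b *\<^sub>R (y - x))" for a b t
    by (simp add: algebra_simps)
  have "convex_on UNIV \<phi>"
  proof (rule convex_onI)
    fix t a b :: real assume "0 < t" "t < 1"
    then show "\<phi> ((1 - t) *\<^sub>R a + t *\<^sub>R b) \<le> (1 - t) * \<phi> a + t * \<phi> b"
      using convex_onD[OF conv, of t "x + a *\<^sub>R (y - x)" "x + b *\<^sub>R (y - x)"]
      by (simp add: \<phi>_def aff)
  qed simp
  moreover have "(\<phi> has_real_derivative G x \<bullet> (y - x)) (at 0 within UNIV)"
    using GDERIV_along_line[OF der, where x = x and v = "y - x" and t = 0]
    by (simp add: \<phi>_def[abs_def])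
  ultimately have "\<phi> 1 - \<phi> 0 \<ge> G x \<bullet> (y - x) * (1 - 0)"
    by (intro convex_on_imp_above_tangent[where A = UNIV]) auto
  then show ?thesis
    by (simp add: \<phi>_def)
qed

lemma smooth_upper_bound:
  assumes der: "\<And>u. GDERIV F u :> G u" and lip: "L-lipschitz_on UNIV G"
  shows "F y \<le> F x + G x \<bullet> (y - x) + L / 2 * (norm (y - x))\<^sup>2"
proof -
  define v where "v = y - x"
  \<comment> \<open>The difference between \<open>F\<close> on the segment and its quadratic model,
    up to a constant. The Lipschitz condition and Cauchy-Schwarz make its derivative nonpositive,
    and comparing the endpoints gives the claim.\<close>
  define \<psi> where "\<psi> t = F (x + t *\<^sub>R v) - t * (G x \<bullet> v) - L / 2 * t\<^sup>2 * (norm v)\<^sup>2" for t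
  have "\<psi> 1 \<le> \<psi> 0"
  proof (rule DERIV_nonpos_imp_nonincreasing[where f = \<psi>])
    fix t :: real assume t: "0 \<le> t" "t \<le> 1"
    have "(\<psi> has_real_derivative G (x + t *\<^sub>R v) \<bullet> v - G x \<bullet> v - L * t * (norm v)\<^sup>2) (at t)"
    proof -
      have "((\<lambda>t. t * (G x \<bullet> v)) has_real_derivative G x \<bullet> v) (at t)"
        "((\<lambda>t. L / 2 * t\<^sup>2 * (norm v)\<^sup>2) has_real_derivative L * t * (norm v)\<^sup>2) (at t)"
        by (auto intro!: derivative_eq_intros)
      then show ?thesis
        unfolding \<psi>_def[abs_def] by (intro DERIV_diff GDERIV_along_line[OF der])
    qed
    moreover have "G (x + t *\<^sub>R v) \<bullet> v - G x \<bullet> v \<le> L * t * (norm v)\<^sup>2"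
    proof -
      have "norm (G (x + t *\<^sub>R v) - G x) \<le> L * (t * norm v)"
        using lipschitz_onD[OF lip, of "x + t *\<^sub>R v" x] t by (simp add: dist_norm)
      then have "norm (G (x + t *\<^sub>R v) - G x) * norm v \<le> L * (t * norm v) * norm v"
        by (rule mult_right_mono) simp
      then have "(G (x + t *\<^sub>R v) - G x) \<bullet> v \<le> L * (t * norm v) * norm v"
        using norm_cauchy_schwarz by (rule order_trans[rotated])
      then show ?thesis
        by (simp add: inner_diff_left power2_eq_square mult.assoc)
    qed
    ultimately show "\<exists>d. (\<psi> has_real_derivative d) (at t) \<and> d \<le> 0"
      by force
  qed simp
  then show ?thesis
    by (simp add: \<psi>_def v_def)
qed

text \<open>
  The tilted function \<open>\<lambda>u. F u - G y \<bullet> u\<close> is minimal at \<open>y\<close>; compare with its value after a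
  gradient step from \<open>x\<close>.
\<close>

lemma convex_smooth_cocoercive:
  assumes "L > 0" and conv: "convex_on UNIV F"
    and der: "\<And>u. GDERIV F u :> G u" and lip: "L-lipschitz_on UNIV G"
  shows "F y + G y \<bullet> (x - y) + (norm (G x - G y))\<^sup>2 / (2 * L) \<le> F x"
proof -
  define d where "d = G x - G y"
  \<comment> \<open>The tilted function has gradient \<open>d\<close> at \<open>x\<close>, and the
    step length \<open>1 / L\<close> minimizes its quadratic upper bound there.\<close>
  define u where "u = x - (1 / L) *\<^sub>R d"
  have "F y + G y \<bullet> (u - y) \<le> F u"
    using conv der by (rule convex_on_gradient_le)
  moreover have "F u \<le> F x + G x \<bullet> (u - x) + L / 2 * (norm (u - x))\<^sup>2"
    using der lip by (rule smooth_upper_bound)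
  moreover have "G x \<bullet> (u - x) - G y \<bullet> (u - y) = - (norm d)\<^sup>2 / L - G y \<bullet> (x - y)"
  proof -
    have "G x \<bullet> (u - x) = - ((G x \<bullet> d) / L)"
      by (simp add: u_def)
    moreover have "G y \<bullet> (u - y) = G y \<bullet> (x - y) - (G y \<bullet> d) / L"
      by (simp add: u_def inner_diff_right)
    moreover have "(norm d)\<^sup>2 = G x \<bullet> d - G y \<bullet> d"
      by (simp add: power2_norm_eq_inner d_def inner_diff inner_commute)
    ultimately show ?thesis
      by (simp add: diff_divide_distrib)
  qed
  moreover have "L / 2 * (norm (u - x))\<^sup>2 = (norm d)\<^sup>2 / (2 * L)"
    using \<open>L > 0\<close> by (simp add: u_def power_divide power2_eq_square)
  ultimately show ?thesis
    by (simp add: d_def field_simps)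
qed

section \<open>The scalar sequences, the error coefficients and the error matrix\<close>

lemma alpha_A_sum_properties:
  assumes "\<And>i. 1 \<le> i \<Longrightarrow> i \<le> k \<Longrightarrow> lam i \<in> {0..1}"
  shows "0 \<le> alpha lam k" "1 \<le> A_sum lam k" "(alpha lam k)\<^sup>2 \<le> A_sum lam k"
proof -
  have "0 \<le> alpha lam k \<and> 1 \<le> A_sum lam k \<and> (alpha lam k)\<^sup>2 \<le> A_sum lam k"
    using assms
  proof (induction k)
    case (Suc k)
    define l a where "l = lam (Suc k)" and "a = A_sum lam k"
    have l: "0 \<le> l" "l \<le> 1" and a: "1 \<le> a"
      using Suc by (auto simp: l_def a_def)
    define r where "r = sqrt (4 * l * a + l\<^sup>2)"
    have r: "0 \<le> r" "r\<^sup>2 = 4 * l * a + l\<^sup>2"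
      using l a by (simp_all add: r_def)
    \<comment> \<open>The new \<open>alpha\<close> is a root of \<open>t^2 = l * (a + t)\<close>, so
      its square is \<open>lam\<close> times the new \<open>A_sum\<close>; then
      \<open>l \<le> 1\<close> applies.\<close>
    have "((l + r) / 2)\<^sup>2 = l * (a + (l + r) / 2)"
      using r(2) by (simp add: field_simps power2_eq_square)
    also have "\<dots> \<le> 1 * (a + (l + r) / 2)"
      using l a r by (intro mult_right_mono) auto
    finally show ?case
      using l a r(1) by (auto simp: add_increasing2 simp flip: l_def a_def r_def)
  qed simp
  then show "0 \<le> alpha lam k" "1 \<le> A_sum lam k" "(alpha lam k)\<^sup>2 \<le> A_sum lam k"
    by auto
qed

lemma sum_alpha: "(\<Sum>i<Suc k. alpha lam i) = A_sum lam k"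
  by (induction k) (simp_all del: alpha.simps(2))

text \<open>Shows where the coefficients come from: the \<open>y\<close>-part of an update carries
  only the latest error, with weight \<open>A_sum lam m\<close>, while the \<open>z\<close>-part
  carries all errors so far, with weights \<open>alpha\<close>. It is used both for error vectors
  and for the constant 1.\<close>

lemma sum_c_coeff:
  fixes v :: "nat \<Rightarrow> 'a::real_vector"
  shows "(\<Sum>i<Suc m. c_coeff lam i (Suc m) *\<^sub>R v i)
    = A_sum lam m *\<^sub>R v m + alpha lam (Suc m) *\<^sub>R (\<Sum>i<Suc m. alpha lam i *\<^sub>R v i)"
proof -
  have "(\<Sum>i<m. c_coeff lam i (Suc m) *\<^sub>R v i)
      = alpha lam (Suc m) *\<^sub>R (\<Sum>i<m. alpha lam i *\<^sub>R v i)"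
    unfolding scaleR_sum_right by (rule sum.cong) (auto simp: c_coeff_def mult.commute)
  then show ?thesis
    by (simp add: c_coeff_def algebra_simps del: alpha.simps)
qed

text \<open>Interchange of summation: \<open>j > max k l\<close> splits into \<open>j > k\<close>
  and \<open>l < j\<close>, and the inner sum over \<open>l\<close> no longer depends on
  \<open>k\<close>.\<close>

lemma H_vec_eq:
  assumes "k < K"
  shows "H_vec L lam K b k =
    (\<Sum>j = k + 1..K. c_coeff lam k j * (\<Sum>l<j. c_coeff lam l j * b l)
       / (2 * L * A_sum lam K * (2 * A_sum lam j - (alpha lam j)\<^sup>2)))"
proof -
  define D where "D j = 2 * L * A_sum lam K * (2 * A_sum lam j - (alpha lam j)\<^sup>2)" for j
  define T where "T l j = c_coeff lam k j * c_coeff lam l j * b l / D j" for l j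
  have "H_vec L lam K b k = (\<Sum>l<K. \<Sum>j = max k l + 1..K. T l j)"
    by (simp add: H_vec_def H_mat_def T_def D_def sum_distrib_right)
  also have "\<dots> = (\<Sum>l<K. \<Sum>j | j \<in> {k + 1..K} \<and> l < j. T l j)"
    by (intro sum.cong refl) auto
  also have "\<dots> = (\<Sum>j = k + 1..K. \<Sum>l | l \<in> {..<K} \<and> l < j. T l j)"
    by (rule sum.swap_restrict) auto
  also have "\<dots> = (\<Sum>j = k + 1..K. \<Sum>l<j. T l j)"
    by (intro sum.cong refl) auto
  also have "\<dots> = (\<Sum>j = k + 1..K. c_coeff lam k j * (\<Sum>l<j. c_coeff lam l j * b l) / D j)"
    by (simp add: T_def sum_divide_distrib sum_distrib_left mult.assoc)
  finally show ?thesis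
    unfolding D_def .
qed

text \<open>\<open>H_mat\<close> is a weighted sum over \<open>j\<close> of rank-one matrices, each
  contributing the square of one linear form in \<open>b\<close>. These squares match the errors
  left by completing the square at each iteration.\<close>

lemma H_quadratic_form:
  "(\<Sum>k<K. b k * H_vec L lam K b k) =
    (\<Sum>j = 1..K. (\<Sum>i<j. c_coeff lam i j * b i)\<^sup>2
       / (2 * L * A_sum lam K * (2 * A_sum lam j - (alpha lam j)\<^sup>2)))"
proof -
  define D where "D j = 2 * L * A_sum lam K * (2 * A_sum lam j - (alpha lam j)\<^sup>2)" for j
  define s where "s j = (\<Sum>i<j. c_coeff lam i j * b i)" for j
  have "(\<Sum>k<K. b k * H_vec L lam K b k)
      = (\<Sum>k<K. \<Sum>j | j \<in> {1..K} \<and> k < j. c_coeff lam k j * b k * s j / D j)"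
    by (intro sum.cong refl)
       (auto simp: H_vec_eq s_def D_def sum_distrib_left mult_ac intro!: sum.cong)
  also have "\<dots> = (\<Sum>j = 1..K. \<Sum>k | k \<in> {..<K} \<and> k < j. c_coeff lam k j * b k * s j / D j)"
    by (rule sum.swap_restrict) auto
  also have "\<dots> = (\<Sum>j = 1..K. \<Sum>k<j. c_coeff lam k j * b k * s j / D j)"
    by (intro sum.cong refl) auto
  also have "\<dots> = (\<Sum>j = 1..K. (s j)\<^sup>2 / D j)"
    by (simp add: s_def power2_eq_square sum_divide_distrib sum_distrib_right)
  finally show ?thesis
    by (simp add: s_def D_def)
qed

lemma u_hat_const:
  assumes "k < K" and b: "\<And>i. i < K \<Longrightarrow> b i = \<beta>" and "\<beta> \<noteq> 0"
  shows "u_hat L lam K b k =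
      (A_sum lam k)\<^sup>2 * (1 + alpha lam (k + 1))
        / (2 * L * A_sum lam K * (2 * A_sum lam (k + 1) - (alpha lam (k + 1))\<^sup>2))
      + (\<Sum>i = k + 1..K. alpha lam k * A_sum lam (i - 1) * alpha lam i * (1 + alpha lam i)
          / (2 * L * A_sum lam K * (2 * A_sum lam i - (alpha lam i)\<^sup>2)))"
proof -
  define D where "D j = 2 * L * A_sum lam K * (2 * A_sum lam j - (alpha lam j)\<^sup>2)" for j
  have row: "(\<Sum>l<j. c_coeff lam l j * b l) = A_sum lam (j - 1) * (1 + alpha lam j) * \<beta>"
    if j: "j \<in> {k + 1..K}" for j
  proof -
    obtain m where m: "j = Suc m"
      using j by (cases j) auto
    have "(\<Sum>l<j. c_coeff lam l j * b l) = (\<Sum>l<j. c_coeff lam l j) * \<beta>"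
      using j b unfolding sum_distrib_right by (intro sum.cong) auto
    also have "(\<Sum>l<j. c_coeff lam l j) = A_sum lam m + alpha lam (Suc m) * A_sum lam m"
      using sum_c_coeff[of lam m "\<lambda>_. 1::real"] sum_alpha[of lam m]
      unfolding m by (simp only: real_scaleR_def mult_1_right)
    finally show ?thesis
      unfolding m by (simp add: algebra_simps del: alpha.simps)
  qed
  have "u_hat L lam K b k
      = (\<Sum>j = k + 1..K. c_coeff lam k j * (A_sum lam (j - 1) * (1 + alpha lam j)) / D j)"
  proof -
    have "H_vec L lam K b k
        = (\<Sum>j = k + 1..K. c_coeff lam k j * (A_sum lam (j - 1) * (1 + alpha lam j)) / D j * \<beta>)"
      unfolding H_vec_eq[OF \<open>k < K\<close>] by (intro sum.cong refl) (simp add: row D_def del: alpha.simps)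
    then show ?thesis
      unfolding u_hat_def b[OF \<open>k < K\<close>] sum_distrib_right[symmetric] using \<open>\<beta> \<noteq> 0\<close> by simp
  qed
  \<comment> \<open>Only \<open>j = k + 1\<close> carries the extra \<open>A_sum lam k\<close> in
    \<open>c_coeff\<close>; together with the row sum at that \<open>j\<close> it produces the
    isolated term.\<close>
  also have "\<dots> = (\<Sum>j = k + 1..K.
      (if j = k + 1 then (A_sum lam k)\<^sup>2 * (1 + alpha lam (k + 1)) / D (k + 1) else 0)
      + alpha lam k * A_sum lam (j - 1) * alpha lam j * (1 + alpha lam j) / D j)"
    by (intro sum.cong refl)
       (auto simp: c_coeff_def power2_eq_square algebra_simps add_divide_distrib simp del: alpha.simps)
  also have "\<dots> = (A_sum lam k)\<^sup>2 * (1 + alpha lam (k + 1)) / D (k + 1)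
      + (\<Sum>j = k + 1..K. alpha lam k * A_sum lam (j - 1) * alpha lam j * (1 + alpha lam j) / D j)"
    using \<open>k < K\<close> by (simp add: sum.distrib del: alpha.simps)
  finally show ?thesis
    unfolding D_def .
qed

section \<open>Growth of the potential in one step and along the method\<close>

lemma neg_inner_le_square_completion:
  fixes p s :: "'a::real_inner"
  assumes "L > 0" "Q > 0"
  shows "- (p \<bullet> s) / L - Q / (2 * L) * (norm p)\<^sup>2 \<le> (norm s)\<^sup>2 / (2 * L * Q)"
proof -
  have "0 \<le> (norm (s + Q *\<^sub>R p))\<^sup>2 / (2 * L * Q)"
    using assms by simp
  also have "\<dots> = (norm s)\<^sup>2 / (2 * L * Q) + (p \<bullet> s) / L + Q / (2 * L) * (norm p)\<^sup>2"
    unfolding power2_norm_eq_inner using assms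
    by (simp add: inner_add inner_commute field_simps)
  finally show ?thesis
    by simp
qed

lemma gradient_step_dist:
  fixes p w u :: "'a::real_inner"
  assumes "L > 0"
  shows "L / 2 * (norm (w - (a / L) *\<^sub>R p - u))\<^sup>2
    = L / 2 * (norm (w - u))\<^sup>2 - a * (p \<bullet> w - p \<bullet> u) + a\<^sup>2 / (2 * L) * (norm p)\<^sup>2"
proof -
  define c where "c = a / L"
  have "w - c *\<^sub>R p - u = (w - u) - c *\<^sub>R p"
    by simp
  then have step: "(norm (w - c *\<^sub>R p - u))\<^sup>2 = (norm (w - u))\<^sup>2 - 2 * (c * (p \<bullet> (w - u))) + c\<^sup>2 * (norm p)\<^sup>2"
    by (simp only: power2_norm_eq_inner inner_diff_left[of "w - u"] inner_diff_right[of _ "w - u"])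
       (simp add: inner_commute power2_eq_square)
  have "a = c * L"
    using assms by (simp add: c_def)
  then show ?thesis
    unfolding c_def[symmetric] step using assms
    by (simp add: inner_diff_right power2_eq_square field_simps)
qed

text \<open>Here \<open>p\<close> and \<open>q\<close> are the exact gradients at the new point
  \<open>x'\<close> and the old point \<open>x\<close>, \<open>u\<close> is the minimizer and
  \<open>s\<close> the accumulated error. Add \<open>prev\<close> with weight \<open>A\<close> and
  \<open>opt\<close> with weight \<open>a\<close>. The relation for \<open>x'\<close> and the
  expansion of the distance then cancel all inner products except \<open>p \<bullet> s\<close>, and
  the total coefficient of \<open>(norm p)^2 / (2 * L)\<close> is
  \<open>a^2 - 2 * (A + a)\<close>.\<close>

lemma potential_step:
  fixes p q s w u x x' :: "'a::real_inner"
  assumes "L > 0" "0 \<le> a" "0 \<le> A" "a\<^sup>2 < 2 * (A + a)"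
    and prev: "F' + p \<bullet> (x - x') + (norm (q - p))\<^sup>2 / (2 * L) \<le> F"
    and opt: "F' + p \<bullet> (u - x') + (norm p)\<^sup>2 / (2 * L) \<le> F0"
    and x': "(A + a) *\<^sub>R x' = A *\<^sub>R x + a *\<^sub>R w - (1 / L) *\<^sub>R (A *\<^sub>R q + s)"
  shows "(A + a) * (F' - F0 - (norm p)\<^sup>2 / (2 * L)) + L / 2 * (norm (w - (a / L) *\<^sub>R p - u))\<^sup>2
    \<le> A * (F - F0 - (norm q)\<^sup>2 / (2 * L)) + L / 2 * (norm (w - u))\<^sup>2
      + (norm s)\<^sup>2 / (2 * L * (2 * (A + a) - a\<^sup>2))"
proof -
  have 1: "A * (F' - F) \<le> A * (p \<bullet> x' - p \<bullet> x - ((norm q)\<^sup>2 - 2 * (p \<bullet> q) + (norm p)\<^sup>2) / (2 * L))"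
    using prev assms(3) unfolding power2_norm_eq_inner
    by (intro mult_left_mono) (auto simp: inner_diff inner_commute algebra_simps)
  have 2: "a * (F' - F0) \<le> a * (p \<bullet> x' - p \<bullet> u - (norm p)\<^sup>2 / (2 * L))"
    using opt assms(2) by (intro mult_left_mono) (auto simp: inner_diff algebra_simps)
  have 3: "(A + a) * (p \<bullet> x') = A * (p \<bullet> x) + a * (p \<bullet> w) - (A * (p \<bullet> q) + p \<bullet> s) / L"
    using arg_cong[OF x', of "\<lambda>v. p \<bullet> v"] by (simp add: inner_diff_right inner_add_right)
  have 4: "L / 2 * (norm (w - (a / L) *\<^sub>R p - u))\<^sup>2
      = L / 2 * (norm (w - u))\<^sup>2 - a * (p \<bullet> w - p \<bullet> u) + a\<^sup>2 / (2 * L) * (norm p)\<^sup>2"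
    using \<open>L > 0\<close> by (rule gradient_step_dist)
  have 5: "- (p \<bullet> s) / L - (2 * (A + a) - a\<^sup>2) / (2 * L) * (norm p)\<^sup>2
      \<le> (norm s)\<^sup>2 / (2 * L * (2 * (A + a) - a\<^sup>2))"
    using assms by (intro neg_inner_le_square_completion) auto
  \<comment> \<open>With these abbreviations the claim becomes linear in products such as
    \<open>A * F'\<close> and \<open>a\<^sup>2 * N\<close>, so that linear arithmetic can combine
    the facts below.\<close>
  define M N r S where "M = (norm q)\<^sup>2 / (2 * L)" and "N = (norm p)\<^sup>2 / (2 * L)"
    and "r = (p \<bullet> q) / L" and "S = (p \<bullet> s) / L"
  note defs = M_def N_def r_def S_def
  have "A * F' - A * F \<le> A * (p \<bullet> x') - A * (p \<bullet> x) - A * M + A * r - A * N"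
  proof -
    have "((norm q)\<^sup>2 - 2 * (p \<bullet> q) + (norm p)\<^sup>2) / (2 * L) = M - r + N"
      by (simp add: defs add_divide_distrib diff_divide_distrib)
    then show ?thesis
      using 1 by (simp only:) (simp add: algebra_simps)
  qed
  moreover have "a * F' - a * F0 \<le> a * (p \<bullet> x') - a * (p \<bullet> u) - a * N"
    using 2 unfolding N_def[symmetric] by (simp add: right_diff_distrib)
  moreover have "A * (p \<bullet> x') + a * (p \<bullet> x') = A * (p \<bullet> x) + a * (p \<bullet> w) - A * r - S"
    using 3 by (simp add: defs distrib_right add_divide_distrib)
  moreover have "L / 2 * (norm (w - (a / L) *\<^sub>R p - u))\<^sup>2
      = L / 2 * (norm (w - u))\<^sup>2 - a * (p \<bullet> w) + a * (p \<bullet> u) + a\<^sup>2 * N"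
    unfolding 4 by (simp add: N_def right_diff_distrib)
  moreover have "- S - 2 * (A * N) - 2 * (a * N) + a\<^sup>2 * N \<le> (norm s)\<^sup>2 / (2 * L * (2 * (A + a) - a\<^sup>2))"
  proof -
    have "- (p \<bullet> s) / L - (2 * (A + a) - a\<^sup>2) / (2 * L) * (norm p)\<^sup>2
        = - S - 2 * (A * N) - 2 * (a * N) + a\<^sup>2 * N"
      using \<open>L > 0\<close> by (simp add: N_def S_def field_simps)
    then show ?thesis
      using 5 by (simp only:)
  qed
  moreover have "(A + a) * (F' - F0 - N) = A * F' + a * F' - A * F0 - a * F0 - A * N - a * N"
    "A * (F - F0 - M) = A * F - A * F0 - A * M"
    by (simp_all add: algebra_simps)
  ultimately show ?thesis
    unfolding M_def[symmetric] N_def[symmetric] by linarith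
qed

text \<open>Telescopes \<open>potential_step\<close>. The exact-gradient sequence runs one index
  ahead: its sum up to \<open>Suc k\<close> already includes the step at \<open>x k\<close>.
  Stationarity of \<open>xstar\<close> turns cocoercivity into the hypothesis
  \<open>opt\<close>.\<close>

lemma iGFGM_potential_bound:
  fixes x y z e :: "nat \<Rightarrow> 'a::euclidean_space"
  assumes "L > 0" and conv: "convex_on UNIV F"
    and der: "\<And>u. GDERIV F u :> G u" and lip: "L-lipschitz_on UNIV G"
    and min: "G xstar = 0"
    and lam: "\<And>k. 1 \<le> k \<Longrightarrow> k \<le> K \<Longrightarrow> lam k \<in> {0..1}"
    and alg: "iGFGM L lam K (\<lambda>k. G (x k) + e k) x y z"
    and "k \<le> K"
  shows "A_sum lam k * (F (x k) - F xstar - (norm (G (x k)))\<^sup>2 / (2 * L))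
      + L / 2 * (norm (x 0 - (1 / L) *\<^sub>R (\<Sum>i<Suc k. alpha lam i *\<^sub>R G (x i)) - xstar))\<^sup>2
    \<le> L / 2 * (norm (x 0 - xstar))\<^sup>2
      + (\<Sum>j = 1..k. (norm (\<Sum>i<j. c_coeff lam i j *\<^sub>R e i))\<^sup>2
          / (2 * L * (2 * A_sum lam j - (alpha lam j)\<^sup>2)))"
  using \<open>k \<le> K\<close>
proof (induction k)
  case 0
  let ?p = "G (x 0)"
  have "F (x 0) + ?p \<bullet> (xstar - x 0) + (norm ?p)\<^sup>2 / (2 * L) \<le> F xstar"
    using convex_smooth_cocoercive[OF \<open>L > 0\<close> conv der lip, of "x 0" xstar] min by simp
  moreover have "L / 2 * (norm (x 0 - (1 / L) *\<^sub>R ?p - xstar))\<^sup>2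
      = L / 2 * (norm (x 0 - xstar))\<^sup>2 + ?p \<bullet> (xstar - x 0) + (norm ?p)\<^sup>2 / (2 * L)"
    using gradient_step_dist[OF \<open>L > 0\<close>, of "x 0" 1 ?p xstar] by (simp add: inner_diff_right)
  \<comment> \<open>The two facts above cancel exactly; the gradient term that the potential
    subtracts is only slack here.\<close>
  moreover have "0 \<le> (norm ?p)\<^sup>2 / (2 * L)"
    using \<open>L > 0\<close> by simp
  ultimately have "F (x 0) - F xstar - (norm ?p)\<^sup>2 / (2 * L)
      + L / 2 * (norm (x 0 - (1 / L) *\<^sub>R ?p - xstar))\<^sup>2 \<le> L / 2 * (norm (x 0 - xstar))\<^sup>2"
    by linarith
  then show ?case
    by simp
next
  case (Suc m)
  define A a where "A = A_sum lam m" and "a = alpha lam (Suc m)"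
  define w where "w = x 0 - (1 / L) *\<^sub>R (\<Sum>i<Suc m. alpha lam i *\<^sub>R G (x i))"
  define s where "s = (\<Sum>i<Suc m. c_coeff lam i (Suc m) *\<^sub>R e i)"
  have A: "1 \<le> A"
    using alpha_A_sum_properties(2)[of m lam] lam Suc.prems by (auto simp: A_def)
  have a: "0 \<le> a" "a\<^sup>2 \<le> A + a"
    using alpha_A_sum_properties(1,3)[of "Suc m" lam] lam Suc.prems
    by (auto simp: A_def a_def simp del: alpha.simps)
  \<comment> \<open>Unrolling \<open>z\<close> shows that \<open>z (Suc m)\<close> and
    \<open>w\<close> differ only by the weighted sum of the errors.\<close>
  have z: "z n = x 0 - (1 / L) *\<^sub>R (\<Sum>i<n. alpha lam i *\<^sub>R (G (x i) + e i))" if "n \<le> K" for n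
    using that
  proof (induction n)
    case 0
    then show ?case using alg by (simp add: iGFGM_def)
  next
    case (Suc n)
    then show ?case using alg by (simp add: iGFGM_def scaleR_add_right del: alpha.simps)
  qed
  have "(A + a) *\<^sub>R x (Suc m) = A *\<^sub>R y (Suc m) + a *\<^sub>R z (Suc m)"
  proof -
    have "x (Suc m) = (1 - a / (A + a)) *\<^sub>R y (Suc m) + (a / (A + a)) *\<^sub>R z (Suc m)"
      using alg Suc.prems by (simp add: iGFGM_def A_def a_def)
    moreover have "(A + a) * (1 - a / (A + a)) = A" "(A + a) * (a / (A + a)) = a"
      using A a by (simp_all add: field_simps)
    ultimately show ?thesis
      by (simp only: scaleR_add_right scaleR_scaleR)
  qed
  moreover have "y (Suc m) = x m - (1 / L) *\<^sub>R (G (x m) + e m)"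
    using alg Suc.prems by (simp add: iGFGM_def)
  moreover have "z (Suc m) = w - (1 / L) *\<^sub>R (\<Sum>i<Suc m. alpha lam i *\<^sub>R e i)"
    using z[of "Suc m"] Suc.prems by (simp add: w_def algebra_simps sum.distrib del: sum.lessThan_Suc)
  moreover have "s = A *\<^sub>R e m + a *\<^sub>R (\<Sum>i<Suc m. alpha lam i *\<^sub>R e i)"
    unfolding s_def A_def a_def by (rule sum_c_coeff)
  ultimately have x_Suc: "(A + a) *\<^sub>R x (Suc m)
      = A *\<^sub>R x m + a *\<^sub>R w - (1 / L) *\<^sub>R (A *\<^sub>R G (x m) + s)"
    by (simp add: algebra_simps del: sum.lessThan_Suc)
  have "(A + a) * (F (x (Suc m)) - F xstar - (norm (G (x (Suc m))))\<^sup>2 / (2 * L))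
        + L / 2 * (norm (w - (a / L) *\<^sub>R G (x (Suc m)) - xstar))\<^sup>2
      \<le> A * (F (x m) - F xstar - (norm (G (x m)))\<^sup>2 / (2 * L)) + L / 2 * (norm (w - xstar))\<^sup>2
        + (norm s)\<^sup>2 / (2 * L * (2 * (A + a) - a\<^sup>2))"
  proof (rule potential_step[OF \<open>L > 0\<close> _ _ _ _ _ x_Suc])
    show "F (x (Suc m)) + G (x (Suc m)) \<bullet> (xstar - x (Suc m)) + (norm (G (x (Suc m))))\<^sup>2 / (2 * L)
        \<le> F xstar"
      using convex_smooth_cocoercive[OF \<open>L > 0\<close> conv der lip, of "x (Suc m)" xstar] min by simp
  qed (use A a convex_smooth_cocoercive[OF \<open>L > 0\<close> conv der lip] in auto)
  moreover have "x 0 - (1 / L) *\<^sub>R (\<Sum>i<Suc (Suc m). alpha lam i *\<^sub>R G (x i))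
      = w - (a / L) *\<^sub>R G (x (Suc m))"
    by (simp add: w_def a_def scaleR_add_right del: alpha.simps)
  moreover have "A_sum lam (Suc m) = A + a"
    by (simp add: A_def a_def)
  ultimately show ?case
    using Suc.IH Suc.prems by (simp flip: w_def s_def A_def a_def del: alpha.simps A_sum.simps sum.lessThan_Suc)
qed

section \<open>The error bound for extended-real-valued \<open>f\<close>\<close>

theorem theorem2:
  fixes f :: "real ^ 'd \<Rightarrow> ereal"
    and x y z e :: "nat \<Rightarrow> real ^ 'd" and xstar :: "real ^ 'd"
    and lam b :: "nat \<Rightarrow> real" and L :: real and K :: nat
  assumes "L > 0"
    and "proper_fun f" and "closed_fun f" and "convex_fun f" and "lipschitz_smooth L f"
    and "is_arg_min f (\<lambda>_. True) xstar"
    and "K \<ge> 1"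
    and "\<And>k. 1 \<le> k \<Longrightarrow> k \<le> K \<Longrightarrow> lam k \<in> {0..1}"
    and "iGFGM L lam K (\<lambda>k. grad f (x k) + e k) x y z"
    and "\<And>k. k < K \<Longrightarrow> b k \<ge> 0"
    and "\<And>k. k < K \<Longrightarrow> (norm (e k))\<^sup>2 \<le> (b k)\<^sup>2"
  shows "f (x K) - (INF w. f w) - ereal (1 / (2 * L) * (norm (grad f (x K)))\<^sup>2)
           \<le> ereal (L * (norm (x 0 - xstar))\<^sup>2 / (2 * A_sum lam K)
                     + (\<Sum>k<K. u_hat L lam K b k * (b k)\<^sup>2))
         \<and> (\<forall>\<beta>>0. (\<forall>i<K. b i = \<beta>) \<longrightarrow>
             (\<forall>k<K. u_hat L lam K b k =
                (A_sum lam k)\<^sup>2 * (1 + alpha lam (k + 1))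
                  / (2 * L * A_sum lam K * (2 * A_sum lam (k + 1) - (alpha lam (k + 1))\<^sup>2))
                + (\<Sum>i = k + 1..K. alpha lam k * A_sum lam (i - 1) * alpha lam i * (1 + alpha lam i)
                    / (2 * L * A_sum lam K * (2 * A_sum lam i - (alpha lam i)\<^sup>2)))))"
proof -
  define F where "F u = real_of_ereal (f u)" for u
  define D where "D j = 2 * A_sum lam j - (alpha lam j)\<^sup>2" for j
  have f: "f u = ereal (F u)" for u
    using assms(5) by (auto simp: F_def lipschitz_smooth_def ereal_real)
  have conv: "convex_on UNIV F"
    unfolding F_def using assms(4,5) by (intro convex_on_real_of_ereal) (auto simp: lipschitz_smooth_def)
  have der: "GDERIV F u :> grad f u" for u
    unfolding F_def using assms(5) by (intro GDERIV_grad) (auto simp: lipschitz_smooth_def)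
  have lip: "L-lipschitz_on UNIV (grad f)"
    using assms(5) by (simp add: lipschitz_smooth_def)
  have f_min: "f xstar \<le> f u" for u
    using assms(6) by (auto simp: is_arg_min_def not_less)
  have min: "grad f xstar = 0"
  proof -
    have "(\<lambda>h. h \<bullet> grad f xstar) = (\<lambda>h. 0)"
      using der[of xstar] f_min unfolding gderiv_def f
      by (intro differential_zero_maxmin[where S = UNIV and f = F and x = xstar]) auto
    then show ?thesis
      by (auto dest: fun_cong[of _ _ "grad f xstar"])
  qed
  have inf: "(INF w. f w) = ereal (F xstar)"
    using f_min unfolding f[symmetric] by (intro antisym INF_lower INF_greatest) auto
  have A: "1 \<le> A_sum lam K"
    using alpha_A_sum_properties(2) assms(8) by blast
  \<comment> \<open>\<open>D j\<close> is at least \<open>A_sum lam j\<close>, since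
    \<open>alpha\<close> squared is at most \<open>A_sum\<close>. Nonnegative coefficients let the
    bounds on the errors pass through the triangle inequality.\<close>
  have D: "0 < D j" and c: "i < j \<Longrightarrow> 0 \<le> c_coeff lam i j" if "j \<le> K" for i j
  proof -
    have lam: "l \<le> j \<Longrightarrow> 1 \<le> i \<Longrightarrow> i \<le> l \<Longrightarrow> lam i \<in> {0..1}" for i l
      using assms(8) that by auto
    show "0 < D j"
      using alpha_A_sum_properties(2,3)[of j lam] lam[of j] by (force simp: D_def)
    show "0 \<le> c_coeff lam i j" if "i < j"
      using alpha_A_sum_properties(1,2)[of i lam, OF lam[of i]] that
        alpha_A_sum_properties(1)[of j lam, OF lam[of j]]
      by (auto simp: c_coeff_def)
  qed
  have err: "(norm (\<Sum>i<j. c_coeff lam i j *\<^sub>R e i))\<^sup>2 \<le> (\<Sum>i<j. c_coeff lam i j * b i)\<^sup>2"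
    if "j \<le> K" for j
  proof (intro power_mono sum_norm_le norm_ge_zero)
    fix i assume "i \<in> {..<j}"
    then have "norm (e i) \<le> b i" "0 \<le> c_coeff lam i j"
      using that assms(10,11)[of i] c[of j i] by (auto intro: power2_le_imp_le)
    then show "norm (c_coeff lam i j *\<^sub>R e i) \<le> c_coeff lam i j * b i"
      by (simp add: mult_left_mono)
  qed
  have "A_sum lam K * (F (x K) - F xstar - (norm (grad f (x K)))\<^sup>2 / (2 * L))
      \<le> L / 2 * (norm (x 0 - xstar))\<^sup>2
        + (\<Sum>j = 1..K. (norm (\<Sum>i<j. c_coeff lam i j *\<^sub>R e i))\<^sup>2 / (2 * L * D j))"
  proof -
    \<comment> \<open>The distance term of the final potential is nonnegative and is
      dropped.\<close>
    have "0 \<le> L / 2 * (norm (x 0 - (1 / L) *\<^sub>R (\<Sum>i<Suc K. alpha lam i *\<^sub>R grad f (x i)) - xstar))\<^sup>2"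
      using \<open>L > 0\<close> by simp
    then show ?thesis
      using iGFGM_potential_bound[OF \<open>L > 0\<close> conv der lip min assms(8,9) order_refl]
      unfolding D_def by linarith
  qed
  also have "\<dots> \<le> L / 2 * (norm (x 0 - xstar))\<^sup>2
      + (\<Sum>j = 1..K. (\<Sum>i<j. c_coeff lam i j * b i)\<^sup>2 / (2 * L * D j))"
    using err D \<open>L > 0\<close> by (intro add_left_mono sum_mono divide_right_mono) (auto simp: less_imp_le)
  \<comment> \<open>The factor \<open>A_sum lam K\<close> in the denominators of
    \<open>H_mat\<close> is restored here, so that dividing by it gives the bound. Writing the
    products as \<open>b k * H_vec L lam K b k\<close> covers vanishing \<open>b k\<close> as
    well.\<close>
  also have "\<dots> = A_sum lam K * (L * (norm (x 0 - xstar))\<^sup>2 / (2 * A_sum lam K)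
      + (\<Sum>k<K. u_hat L lam K b k * (b k)\<^sup>2))"
    unfolding u_hat_times_square H_quadratic_form D_def[symmetric] using A
    by (simp add: distrib_left sum_distrib_left mult_ac)
  finally have "F (x K) - F xstar - (norm (grad f (x K)))\<^sup>2 / (2 * L)
      \<le> L * (norm (x 0 - xstar))\<^sup>2 / (2 * A_sum lam K) + (\<Sum>k<K. u_hat L lam K b k * (b k)\<^sup>2)"
    using A by simp
  moreover have "\<forall>\<beta>>0. (\<forall>i<K. b i = \<beta>) \<longrightarrow>
      (\<forall>k<K. u_hat L lam K b k =
         (A_sum lam k)\<^sup>2 * (1 + alpha lam (k + 1))
           / (2 * L * A_sum lam K * (2 * A_sum lam (k + 1) - (alpha lam (k + 1))\<^sup>2))
         + (\<Sum>i = k + 1..K. alpha lam k * A_sum lam (i - 1) * alpha lam i * (1 + alpha lam i)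
             / (2 * L * A_sum lam K * (2 * A_sum lam i - (alpha lam i)\<^sup>2))))"
    by (intro allI impI u_hat_const) auto
  ultimately show ?thesis
    unfolding inf f[of "x K"] by simp
qed

end
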